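(* Let $X$ and $Y$ be real Banach spaces, and let $(x,y) \in S_{X \oplus_1 Y}$. Then: (a) $dc((x,y)) \geq \min \left\{ dc\left( \frac{x}{\|x\|}\right), dc\left( \frac{y}{\|y\|}\right) \right\}$ when $x\neq 0$ and $y\neq 0$; (b) $dc((x,y)) \geq dc(y)$ when $x=0$; (c) $dc((x,y)) \geq dc(x)$ when $y = 0$.
   Context: $X\oplus_1 Y$ is $X\times Y$ with norm $\|(x,y)\|=\|x\|+\|y\|$. For a Banach space $Z$, $B_Z$, $S_Z$, $Z^*$ denote the closed unit ball, unit sphere and topological dual. A slice of $B_Z$ is a set $S(z^*,\delta)=\{w\in B_Z : z^*(w)>1-\delta\}$ with $z^*\in S_{Z^*}$ and $\delta>0$. For $z\in B_Z$, the Daugavet constant $dc(z)$ (computed in the space $Z$ in which $z$ lies) is the supremum of all $\alpha\ge 0$ such that for all $\varepsilon,\delta>0$ and all $z^*\in S_{Z^*}$ there exists $w\in S(z^*,\delta)$ with $\|w-z\|>\alpha-\varepsilon$. *)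

theory Defs
  imports "HOL-Analysis.Analysis" "HOL-Library.Extended_Real"
begin

text \<open>
  The library already equips the product type with the Euclidean norm, so the \<open>\<ell>\<^sub>1\<close>-sum
  of two normed spaces is a separate copy of the product.
\<close>

datatype ('a, 'b) l1_sum = L1 (l1_fst: 'a) (l1_snd: 'b)

instantiation l1_sum :: (real_vector, real_vector) real_vector
begin

definition zero_l1_sum :: "('a, 'b) l1_sum"
  where "0 = L1 0 0"

definition plus_l1_sum :: "('a, 'b) l1_sum \<Rightarrow> ('a, 'b) l1_sum \<Rightarrow> ('a, 'b) l1_sum"
  where "u + v = L1 (l1_fst u + l1_fst v) (l1_snd u + l1_snd v)"

definition minus_l1_sum :: "('a, 'b) l1_sum \<Rightarrow> ('a, 'b) l1_sum \<Rightarrow> ('a, 'b) l1_sum"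
  where "u - v = L1 (l1_fst u - l1_fst v) (l1_snd u - l1_snd v)"

definition uminus_l1_sum :: "('a, 'b) l1_sum \<Rightarrow> ('a, 'b) l1_sum"
  where "- u = L1 (- l1_fst u) (- l1_snd u)"

definition scaleR_l1_sum :: "real \<Rightarrow> ('a, 'b) l1_sum \<Rightarrow> ('a, 'b) l1_sum"
  where "r *\<^sub>R u = L1 (r *\<^sub>R l1_fst u) (r *\<^sub>R l1_snd u)"

instance
  by standard
    (simp_all add: zero_l1_sum_def plus_l1_sum_def minus_l1_sum_def uminus_l1_sum_def
      scaleR_l1_sum_def algebra_simps l1_sum.expand)

end

lemma l1_fst_simps [simp]:
  "l1_fst 0 = 0" "l1_fst (u + v) = l1_fst u + l1_fst v" "l1_fst (u - v) = l1_fst u - l1_fst v"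
  "l1_fst (- u) = - l1_fst u" "l1_fst (r *\<^sub>R u) = r *\<^sub>R l1_fst u"
  by (simp_all add: zero_l1_sum_def plus_l1_sum_def minus_l1_sum_def uminus_l1_sum_def
      scaleR_l1_sum_def)

lemma l1_snd_simps [simp]:
  "l1_snd 0 = 0" "l1_snd (u + v) = l1_snd u + l1_snd v" "l1_snd (u - v) = l1_snd u - l1_snd v"
  "l1_snd (- u) = - l1_snd u" "l1_snd (r *\<^sub>R u) = r *\<^sub>R l1_snd u"
  by (simp_all add: zero_l1_sum_def plus_l1_sum_def minus_l1_sum_def uminus_l1_sum_def
      scaleR_l1_sum_def)

instantiation l1_sum :: (real_normed_vector, real_normed_vector) real_normed_vector
begin

definition norm_l1_sum :: "('a, 'b) l1_sum \<Rightarrow> real"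
  where "norm_l1_sum u = norm (l1_fst u) + norm (l1_snd u)"

definition dist_l1_sum :: "('a, 'b) l1_sum \<Rightarrow> ('a, 'b) l1_sum \<Rightarrow> real"
  where "dist_l1_sum u v = norm (u - v)"

definition sgn_l1_sum :: "('a, 'b) l1_sum \<Rightarrow> ('a, 'b) l1_sum"
  where "sgn_l1_sum u = u /\<^sub>R norm u"

definition uniformity_l1_sum :: "(('a, 'b) l1_sum \<times> ('a, 'b) l1_sum) filter"
  where [code del]: "uniformity_l1_sum = (INF e\<in>{0 <..}. principal {(u, v). dist u v < e})"

definition open_l1_sum :: "('a, 'b) l1_sum set \<Rightarrow> bool"
  where [code del]: "open_l1_sum U \<longleftrightarrow> (\<forall>u\<in>U. \<forall>\<^sub>F (u', v) in uniformity. u' = u \<longrightarrow> v \<in> U)"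

instance
proof
  fix u v :: "('a, 'b) l1_sum" and r :: real
  show "norm u = 0 \<longleftrightarrow> u = 0"
    by (auto simp: norm_l1_sum_def add_nonneg_eq_0_iff l1_sum.expand)
  show "norm (u + v) \<le> norm u + norm v"
    using norm_triangle_ineq[of "l1_fst u" "l1_fst v"] norm_triangle_ineq[of "l1_snd u" "l1_snd v"]
    by (simp add: norm_l1_sum_def)
  show "norm (r *\<^sub>R u) = \<bar>r\<bar> * norm u"
    by (simp add: norm_l1_sum_def distrib_left)
qed (rule dist_l1_sum_def sgn_l1_sum_def uniformity_l1_sum_def open_l1_sum_def)+

end

instance l1_sum :: (banach, banach) banach
proof
  fix s :: "nat \<Rightarrow> ('a, 'b) l1_sum"
  assume s: "Cauchy s"
  have "Cauchy (\<lambda>n. l1_fst (s n))" "Cauchy (\<lambda>n. l1_snd (s n))"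
    using s unfolding Cauchy_def dist_norm norm_l1_sum_def
    by (force intro: le_less_trans[rotated])+
  then obtain a b where "(\<lambda>n. l1_fst (s n)) \<longlonglongrightarrow> a" "(\<lambda>n. l1_snd (s n)) \<longlonglongrightarrow> b"
    by (auto simp: Cauchy_convergent_iff convergent_def)
  then have "(\<lambda>n. norm (l1_fst (s n) - a) + norm (l1_snd (s n) - b)) \<longlonglongrightarrow> 0"
    by (auto intro!: tendsto_eq_intros simp: LIM_zero_iff tendsto_norm_zero_iff)
  then have "(\<lambda>n. norm (s n - L1 a b)) \<longlonglongrightarrow> 0"
    by (simp add: norm_l1_sum_def)
  then show "convergent s"
    by (auto simp: convergent_def tendsto_norm_zero_iff LIM_zero_iff)
qed

text \<open>The dual of a real normed space \<open>'a\<close> is \<open>'a \<Rightarrow>\<^sub>L real\<close> with the operator norm.\<close>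

definition slice :: "('a::real_normed_vector \<Rightarrow>\<^sub>L real) \<Rightarrow> real \<Rightarrow> 'a set"
  where "slice f \<delta> = {w \<in> cball 0 1. blinfun_apply f w > 1 - \<delta>}"

text \<open>
  The supremum is taken in the extended reals, so that it is a genuine supremum in every
  space. It is infinite only if the dual unit sphere is empty; otherwise, at points of the
  unit ball, it lies between 0 and 2.
\<close>

definition dc :: "'a::real_normed_vector \<Rightarrow> ereal"
  where "dc z = Sup {ereal \<alpha> | \<alpha>. \<alpha> \<ge> 0 \<and>
    (\<forall>\<epsilon>>0. \<forall>\<delta>>0. \<forall>f \<in> sphere (0 :: 'a \<Rightarrow>\<^sub>L real) 1.
      \<exists>w \<in> slice f \<delta>. norm (w - z) > \<alpha> - \<epsilon>)}"

end

theory Submission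
  imports Defs
begin

text \<open>
  A norm-one functional on the \<open>\<ell>\<^sub>1\<close>-sum restricts to a norm-one functional on one of the two
  summands, since the dual norm is the maximum of the two restricted norms. A point \<open>w\<close> of the slice
  of that summand then gives a point \<open>(w, 0)\<close> or \<open>(0, w)\<close> of the given slice. When both
  coordinates are non-zero, \<open>\<parallel>w - x\<parallel> + \<parallel>y\<parallel> \<ge> \<parallel>w - x / \<parallel>x\<parallel>\<parallel>\<close> because \<open>\<parallel>x\<parallel> + \<parallel>y\<parallel> = 1\<close>. When \<open>x = 0\<close> and
  the functional lives on the first summand, the distance is \<open>\<parallel>w\<parallel> + 1\<close>, close to \<open>2\<close>, and \<open>2\<close>
  bounds the Daugavet constant of \<open>y\<close> as soon as the dual sphere is non-empty. This last point
  needs the Hahn--Banach theorem, which is proved by showing that a minimal sublinear functional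
  is linear.
\<close>

section \<open>The Hahn--Banach theorem\<close>

definition sublinear :: "('a::real_vector \<Rightarrow> real) \<Rightarrow> bool"
  where "sublinear p \<longleftrightarrow> (\<forall>v w. p (v + w) \<le> p v + p w) \<and> (\<forall>r\<ge>0. \<forall>v. p (r *\<^sub>R v) = r * p v)"

lemma sublinear_add: "sublinear p \<Longrightarrow> p (v + w) \<le> p v + p w"
  by (simp add: sublinear_def)

lemma sublinear_scaleR: "sublinear p \<Longrightarrow> r \<ge> 0 \<Longrightarrow> p (r *\<^sub>R v) = r * p v"
  by (simp add: sublinear_def)

lemma sublinear_zero: "sublinear p \<Longrightarrow> p 0 = 0"
  using sublinear_scaleR[of p 0 0] by simp

lemma sublinear_ge: "sublinear p \<Longrightarrow> - p (- v) \<le> p v"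
  using sublinear_add[of p v "- v"] by (simp add: sublinear_zero)

lemma sublinear_norm: "sublinear norm"
  by (simp add: sublinear_def norm_triangle_ineq)

text \<open>For r > 0 one inequality suffices: applied to \<open>inverse r\<close> and
  \<open>r *\<^sub>R v\<close>, it yields the reverse one.\<close>

lemma sublinearI:
  assumes add: "\<And>v w. p (v + w) \<le> p v + p w"
    and scale: "\<And>r v. r > 0 \<Longrightarrow> p (r *\<^sub>R v) \<le> r * p v"
    and zero: "p 0 = 0"
  shows "sublinear p"
  unfolding sublinear_def
proof (intro conjI allI impI add)
  fix r :: real and v assume "r \<ge> 0"
  show "p (r *\<^sub>R v) = r * p v"
  proof (cases "r = 0")
    case False
    with \<open>r \<ge> 0\<close> have r: "r > 0" by simp
    have "p (inverse r *\<^sub>R r *\<^sub>R v) \<le> inverse r * p (r *\<^sub>R v)"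
      using r by (intro scale) simp
    then have "r * p v \<le> p (r *\<^sub>R v)"
      using r by (simp add: field_simps)
    with scale[OF r, of v] show ?thesis by simp
  qed (simp add: zero)
qed

text \<open>The largest sublinear functional below \<open>p\<close> whose value at \<open>- u\<close> is at most \<open>- p u\<close>.\<close>

definition sublinear_shift :: "('a::real_vector \<Rightarrow> real) \<Rightarrow> 'a \<Rightarrow> 'a \<Rightarrow> real"
  where "sublinear_shift p u v = (INF t\<in>{0..}. p (v + t *\<^sub>R u) - t * p u)"

lemma sublinear_shift_le:
  assumes "sublinear p" "t \<ge> 0"
  shows "sublinear_shift p u v \<le> p (v + t *\<^sub>R u) - t * p u"
  unfolding sublinear_shift_def
proof (rule cINF_lower)
  show "bdd_below ((\<lambda>t. p (v + t *\<^sub>R u) - t * p u) ` {0..})"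
  \<comment> \<open>A real infimum needs a lower bound: s * p u is p at s times u, which
    subadditivity bounds by \<open>p (v + s *\<^sub>R u) + p (- v)\<close>.\<close>
  proof (rule bdd_belowI2[of _ "- p (- v)"])
    fix s :: real assume "s \<in> {0..}"
    then show "- p (- v) \<le> p (v + s *\<^sub>R u) - s * p u"
      using sublinear_add[OF assms(1), of "v + s *\<^sub>R u" "- v"] sublinear_scaleR[OF assms(1), of s u]
      by simp
  qed
qed (use assms in simp)

lemma sublinear_shift_greatest:
  "(\<And>t. t \<ge> 0 \<Longrightarrow> c \<le> p (v + t *\<^sub>R u) - t * p u) \<Longrightarrow> c \<le> sublinear_shift p u v"
  unfolding sublinear_shift_def by (rule cINF_greatest) auto

text \<open>Parameters s for v and t for w combine to s + t for v + w; the parameter t for v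
  rescales to r * t for r times v.\<close>

lemma sublinear_shift_sublinear:
  assumes "sublinear p"
  shows "sublinear (sublinear_shift p u)"
proof (rule sublinearI)
  fix v w
  have *: "sublinear_shift p u (v + w) \<le> (p (v + s *\<^sub>R u) - s * p u) + (p (w + t *\<^sub>R u) - t * p u)"
    if "s \<ge> 0" "t \<ge> 0" for s t
    using sublinear_shift_le[OF assms, of "s + t" u "v + w"]
      sublinear_add[OF assms, of "v + s *\<^sub>R u" "w + t *\<^sub>R u"] that
    by (simp add: algebra_simps)
  \<comment> \<open>The infimum over t is taken first, with s fixed; the infimum over s
    follows.\<close>
  have "sublinear_shift p u (v + w) - (p (v + s *\<^sub>R u) - s * p u) \<le> sublinear_shift p u w"
    if "s \<ge> 0" for s
    using *[OF that] by (intro sublinear_shift_greatest) (simp add: algebra_simps)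
  then have "sublinear_shift p u (v + w) - sublinear_shift p u w \<le> sublinear_shift p u v"
    by (intro sublinear_shift_greatest) (simp add: algebra_simps)
  then show "sublinear_shift p u (v + w) \<le> sublinear_shift p u v + sublinear_shift p u w"
    by simp
next
  fix r :: real and v assume r: "r > 0"
  have "inverse r * sublinear_shift p u (r *\<^sub>R v) \<le> sublinear_shift p u v"
  proof (rule sublinear_shift_greatest)
    fix t :: real assume "t \<ge> 0"
    have "sublinear_shift p u (r *\<^sub>R v) \<le> p (r *\<^sub>R v + (r * t) *\<^sub>R u) - r * t * p u"
      using assms r \<open>t \<ge> 0\<close> by (intro sublinear_shift_le) auto
    also have "\<dots> = r * (p (v + t *\<^sub>R u) - t * p u)"
      using sublinear_scaleR[OF assms, of r "v + t *\<^sub>R u"] r by (simp add: algebra_simps)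
    finally show "inverse r * sublinear_shift p u (r *\<^sub>R v) \<le> p (v + t *\<^sub>R u) - t * p u"
      using r by (simp add: field_simps)
  qed
  then show "sublinear_shift p u (r *\<^sub>R v) \<le> r * sublinear_shift p u v"
    using r by (simp add: field_simps)
next
  show "sublinear_shift p u 0 = 0"
    \<comment> \<open>Parameter 0 bounds the infimum above by p 0 = 0; at the point 0 every term is
      t * p u - t * p u = 0.\<close>
    using sublinear_shift_le[OF assms, of 0 u 0]
    by (intro antisym sublinear_shift_greatest)
       (simp_all add: sublinear_zero[OF assms] sublinear_scaleR[OF assms])
qed

text \<open>Subadditivity comes from comparability: the smaller m of q and q' satisfies m v + m w
  \<le> q v + q' w.\<close>

lemma sublinear_INF:
  fixes C :: "('a::real_vector \<Rightarrow> real) set"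
  assumes "C \<noteq> {}" and sub: "\<And>q. q \<in> C \<Longrightarrow> sublinear q"
    and bdd: "\<And>v. bdd_below ((\<lambda>q. q v) ` C)"
    and chain: "\<And>q q'. q \<in> C \<Longrightarrow> q' \<in> C \<Longrightarrow> q \<le> q' \<or> q' \<le> q"
  shows "sublinear (\<lambda>v. INF q\<in>C. q v)"
proof (rule sublinearI)
  let ?I = "\<lambda>v. INF q\<in>C. q v"
  have lower: "?I v \<le> q v" if "q \<in> C" for q v
    using bdd that by (rule cINF_lower)
  have greatest: "c \<le> ?I v" if "\<And>q. q \<in> C \<Longrightarrow> c \<le> q v" for c v
    using \<open>C \<noteq> {}\<close> that by (rule cINF_greatest)
  fix v w
  have *: "?I (v + w) \<le> q v + q' w" if qq': "q \<in> C" "q' \<in> C" for q q'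
  proof -
    obtain m where m: "m \<in> C" "m \<le> q" "m \<le> q'"
      using chain[OF qq'] qq' by blast
    have "?I (v + w) \<le> m v + m w"
      using lower[OF m(1)] sublinear_add[OF sub[OF m(1)]] by (rule order_trans)
    also have "\<dots> \<le> q v + q' w"
      using m(2,3) by (intro add_mono) (auto simp: le_fun_def)
    finally show ?thesis .
  qed
  have "?I (v + w) - q v \<le> ?I w" if "q \<in> C" for q
    using *[OF that] by (intro greatest) (simp add: algebra_simps)
  then have "?I (v + w) - ?I w \<le> ?I v"
    by (intro greatest) (simp add: algebra_simps)
  then show "?I (v + w) \<le> ?I v + ?I w"
    by simp
  show "?I (r *\<^sub>R v) \<le> r * ?I v" if r: "r > 0" for r v
  proof -
    have "inverse r * ?I (r *\<^sub>R v) \<le> ?I v"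
    proof (rule greatest)
      fix q assume "q \<in> C"
      then have "?I (r *\<^sub>R v) \<le> r * q v"
        using lower[of q "r *\<^sub>R v"] sublinear_scaleR[OF sub, of q r v] r by simp
      then show "inverse r * ?I (r *\<^sub>R v) \<le> q v"
        using r by (simp add: field_simps)
    qed
    then show ?thesis
      using r by (simp add: field_simps)
  qed
  show "?I 0 = 0"
    using \<open>C \<noteq> {}\<close> by (simp add: sublinear_zero[OF sub] cong: INF_cong_simp)
qed

text \<open>By minimality the shift of m by any u is m itself. Its parameter 1 then gives m v \<le>
  m (v + u) - m u, the converse of subadditivity.\<close>

lemma minimal_sublinear_linear:
  assumes sub: "sublinear m" and minimal: "\<And>q. sublinear q \<Longrightarrow> q \<le> m \<Longrightarrow> q = m"
  shows "linear m"
proof -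
  have add: "m (v + u) = m v + m u" for u v
  proof -
    have "sublinear_shift m u \<le> m"
      using sublinear_shift_le[OF sub, of 0 u] by (auto simp: le_fun_def)
    then have "sublinear_shift m u = m"
      using minimal sublinear_shift_sublinear[OF sub] by blast
    then have "m v \<le> m (v + u) - m u"
      using sublinear_shift_le[OF sub, of 1 u v] by simp
    with sublinear_add[OF sub, of v u] show ?thesis by simp
  qed
  have minus: "m (- v) = - m v" for v
    using add[of v "- v"] by (simp add: sublinear_zero[OF sub])
  show ?thesis
  proof (rule linearI)
    fix r :: real and v
    show "m (r *\<^sub>R v) = r *\<^sub>R m v"
      \<comment> \<open>A negative r is reduced to - r by oddness.\<close>
      using sublinear_scaleR[OF sub, of r v] sublinear_scaleR[OF sub, of "- r" v] minus[of "r *\<^sub>R v"]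
      by (cases "r \<ge> 0") auto
  qed (rule add)
qed

text \<open>Zorn's lemma gives a minimal sublinear functional below p. A non-empty chain has its
  pointwise infimum as lower bound, finite because q v \<ge> - q (- v) \<ge> - p (- v).\<close>

theorem sublinear_dominates_linear:
  fixes p :: "'a::real_vector \<Rightarrow> real"
  assumes p: "sublinear p"
  obtains g where "linear g" "g \<le> p"
proof -
  let ?A = "{q. sublinear q \<and> q \<le> p}"
  have "\<exists>m\<in>?A. \<forall>q\<in>?A. m \<ge> q \<longrightarrow> q = m"
  proof (rule predicate_Zorn)
    \<comment> \<open>The order is reversed, so that a maximal element is a minimal
      functional.\<close>
    show "partial_order_on ?A (relation_of (\<ge>) ?A)"
      by (rule partial_order_on_relation_ofI) auto
  next
    fix C assume C: "C \<in> Chains (relation_of (\<ge>) ?A)"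
    have CA: "C \<subseteq> ?A"
      using C by (rule Chains_relation_of)
    show "\<exists>u\<in>?A. \<forall>a\<in>C. a \<ge> u"
    proof (cases "C = {}")
      case False
      have bdd: "bdd_below ((\<lambda>q. q v) ` C)" for v
      proof (rule bdd_belowI2)
        fix q assume "q \<in> C"
        then have "sublinear q" "q (- v) \<le> p (- v)"
          using CA by (auto simp: le_fun_def)
        then show "- p (- v) \<le> q v"
          using sublinear_ge[of q v] by simp
      qed
      have lower: "(INF q\<in>C. q v) \<le> q v" if "q \<in> C" for q v
        using bdd that by (rule cINF_lower)
      have "sublinear (\<lambda>v. INF q\<in>C. q v)"
        using False CA bdd C by (intro sublinear_INF) (auto simp: Chains_def relation_of_def)
      moreover have "(\<lambda>v. INF q\<in>C. q v) \<le> q" if "q \<in> C" for q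
        using lower[OF that] by (simp add: le_fun_def)
      moreover obtain q where "q \<in> C" using False by blast
      ultimately show ?thesis
        using CA by (intro bexI[of _ "\<lambda>v. INF q\<in>C. q v"]) (auto intro: order_trans)
    qed (use p in auto)
  qed
  then obtain m where m: "sublinear m" "m \<le> p" "\<And>q. sublinear q \<Longrightarrow> q \<le> p \<Longrightarrow> q \<le> m \<Longrightarrow> q = m"
    by blast
  \<comment> \<open>Minimality below p is minimality among all sublinear functionals, since whatever
    lies below m lies below p.\<close>
  then have "linear m"
    by (intro minimal_sublinear_linear) (auto intro: order_trans)
  with m(2) show ?thesis
    using that by blast
qed

text \<open>Dominating g by the shift of the norm at z builds in the value at z: parameter 0 gives g
  \<le> norm, and parameter 1 at - z gives g (- z) \<le> - norm z.\<close>

theorem norming_functional: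
  fixes z :: "'a::real_normed_vector"
  assumes "z \<noteq> 0"
  obtains f :: "'a \<Rightarrow>\<^sub>L real" where "norm f = 1" "f z = norm z"
proof -
  obtain g where g: "linear g" "g \<le> sublinear_shift norm z"
    using sublinear_dominates_linear sublinear_shift_sublinear[OF sublinear_norm] by blast
  have le: "g v \<le> norm v" for v
    using g(2) sublinear_shift_le[OF sublinear_norm, of 0 z v] by (simp add: le_fun_def) (meson order_trans)
  have abs_le: "\<bar>g v\<bar> \<le> norm v" for v
    using le[of v] le[of "- v"] by (simp add: linear_neg[OF g(1)] abs_le_iff)
  have "g (- z) \<le> - norm z"
    using g(2) sublinear_shift_le[OF sublinear_norm, of 1 z "- z"]
    by (simp add: le_fun_def) (meson order_trans)
  with le[of z] have gz: "g z = norm z"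
    by (simp add: linear_neg[OF g(1)])
  have "bounded_linear g"
    using g(1) abs_le by (auto simp: bounded_linear_def bounded_linear_axioms_def intro!: exI[of _ 1])
  then have ap: "blinfun_apply (Blinfun g) = g"
    by (rule bounded_linear_Blinfun_apply)
  have "norm (Blinfun g) = 1"
    by (rule norm_blinfun_eqI[where x = z]) (use abs_le assms in \<open>auto simp: ap gz\<close>)
  with ap gz that show ?thesis by metis
qed

section \<open>Slices and Daugavet constants\<close>

text \<open>The condition inside the supremum of \<open>dc\<close>, isolated so that real bounds can
  be compared before suprema are taken.\<close>

definition daugavet_bound :: "real \<Rightarrow> 'a::real_normed_vector \<Rightarrow> bool"
  where "daugavet_bound \<alpha> z \<longleftrightarrow> (\<forall>\<epsilon>>0. \<forall>\<delta>>0. \<forall>f \<in> sphere (0 :: 'a \<Rightarrow>\<^sub>L real) 1.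
      \<exists>w \<in> slice f \<delta>. norm (w - z) > \<alpha> - \<epsilon>)"

lemma dc_eq_Sup: "dc z = Sup {ereal \<alpha> | \<alpha>. \<alpha> \<ge> 0 \<and> daugavet_bound \<alpha> z}"
  by (simp add: dc_def daugavet_bound_def)

lemma daugavet_boundD:
  fixes f :: "'a::real_normed_vector \<Rightarrow>\<^sub>L real"
  assumes "daugavet_bound \<alpha> z" "norm f = 1" "\<epsilon> > 0" "\<delta> > 0"
  obtains w where "w \<in> slice f \<delta>" "norm (w - z) > \<alpha> - \<epsilon>"
proof -
  have "f \<in> sphere 0 1" using assms(2) by simp
  with assms(1,3,4) that show ?thesis
    unfolding daugavet_bound_def by blast
qed

lemma daugavet_bound_mono: "daugavet_bound \<alpha> z \<Longrightarrow> \<beta> \<le> \<alpha> \<Longrightarrow> daugavet_bound \<beta> z"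
  unfolding daugavet_bound_def by (meson diff_right_mono le_less_trans)

lemma le_dcI: "daugavet_bound \<alpha> z \<Longrightarrow> \<alpha> \<ge> 0 \<Longrightarrow> ereal \<alpha> \<le> dc z"
  unfolding dc_eq_Sup by (rule Sup_upper) blast

lemma less_dcD:
  assumes "c < dc z"
  obtains \<alpha> where "\<alpha> \<ge> 0" "daugavet_bound \<alpha> z" "c < ereal \<alpha>"
  using assms unfolding dc_eq_Sup less_Sup_iff by auto

lemma dc_le_dcI:
  assumes "\<And>\<alpha>. daugavet_bound \<alpha> z \<Longrightarrow> daugavet_bound \<alpha> u"
  shows "dc z \<le> dc u"
  unfolding dc_eq_Sup by (rule Sup_subset_mono) (use assms in blast)

lemma slice_mono: "\<delta> \<le> \<eta> \<Longrightarrow> slice f \<delta> \<subseteq> slice f \<eta>"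
  by (auto simp: slice_def)

text \<open>An empty slice would mean f \<le> 1 - \<delta> on the unit ball, hence
  \<open>norm f\<close> < 1.\<close>

lemma slice_nonempty:
  fixes f :: "'a::real_normed_vector \<Rightarrow>\<^sub>L real"
  assumes "norm f = 1" "\<delta> > 0"
  shows "slice f \<delta> \<noteq> {}"
proof
  assume "slice f \<delta> = {}"
  then have le: "f w \<le> 1 - \<delta>" if "norm w \<le> 1" for w
    using that by (force simp: slice_def)
  have "norm f \<le> 1 - \<delta>"
  proof (rule norm_blinfun_bound)
    \<comment> \<open>The operator norm bound must be non-negative; the point 0 of the ball shows
      that it is.\<close>
    show "0 \<le> 1 - \<delta>"
      using le[of 0] by (simp add: blinfun.zero_right)
    fix v
    show "norm (f v) \<le> (1 - \<delta>) * norm v"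
    proof (cases "v = 0")
      case False
      then show ?thesis
        using le[of "v /\<^sub>R norm v"] le[of "- (v /\<^sub>R norm v)"]
        by (auto simp: blinfun.scaleR_right blinfun.minus_right field_simps abs_le_iff)
    qed (simp add: blinfun.zero_right)
  qed
  with assms show False by simp
qed

text \<open>Since f has norm one, \<open>f w\<close> > 1 - \<epsilon> forces \<open>norm w\<close> >
  1 - \<epsilon>; a slice of width \<open>min \<delta> \<epsilon>\<close> serves both
  demands.\<close>

lemma slice_norm_gt:
  fixes f :: "'a::real_normed_vector \<Rightarrow>\<^sub>L real"
  assumes "norm f = 1" "\<delta> > 0" "\<epsilon> > 0"
  obtains w where "w \<in> slice f \<delta>" "norm w > 1 - \<epsilon>"
proof -
  obtain w where w: "w \<in> slice f (min \<delta> \<epsilon>)"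
    using slice_nonempty[of f "min \<delta> \<epsilon>"] assms by auto
  then have "1 - \<epsilon> < f w"
    by (auto simp: slice_def min_def split: if_splits)
  also have "\<dots> \<le> norm w"
    using norm_blinfun[of f w] assms(1) by simp
  finally show ?thesis
    using that w slice_mono[of "min \<delta> \<epsilon>" \<delta> f] by auto
qed

text \<open>The functional norming z keeps the condition from being vacuous. Any slice point w has
  norm at most 1, so its distance to z is at most 2; the width 1 is arbitrary.\<close>

lemma daugavet_bound_le_2:
  assumes "daugavet_bound \<alpha> z" "norm z = 1"
  shows "\<alpha> \<le> 2"
proof (rule field_le_epsilon)
  fix \<epsilon> :: real assume "\<epsilon> > 0"
  have "z \<noteq> 0" using assms(2) by auto
  then obtain f :: "'a \<Rightarrow>\<^sub>L real" where "norm f = 1"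
    by (rule norming_functional)
  then obtain w where w: "w \<in> slice f 1" "norm (w - z) > \<alpha> - \<epsilon>"
    using daugavet_boundD[OF assms(1) _ \<open>\<epsilon> > 0\<close>] by (metis zero_less_one)
  then show "\<alpha> \<le> 2 + \<epsilon>"
    using norm_triangle_ineq4[of w z] assms(2) by (simp add: slice_def)
qed

section \<open>Slices of the sum\<close>

lemma bounded_linear_L1_left:
  "bounded_linear (\<lambda>a. L1 a 0 :: ('a::real_normed_vector, 'b::real_normed_vector) l1_sum)"
  by (rule bounded_linear_intro[where K = 1])
     (simp_all add: plus_l1_sum_def scaleR_l1_sum_def norm_l1_sum_def)

lemma bounded_linear_L1_right:
  "bounded_linear (\<lambda>b. L1 0 b :: ('a::real_normed_vector, 'b::real_normed_vector) l1_sum)"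
  by (rule bounded_linear_intro[where K = 1])
     (simp_all add: plus_l1_sum_def scaleR_l1_sum_def norm_l1_sum_def)

text \<open>With g and h the restrictions of f, |f (a, b)| \<le> |g| |a| + |h| |b| \<le> max |g| |h|
  * (|a| + |b|). Both restrictions have norm at most 1, so one of them attains it.\<close>

lemma l1_sum_dual_cases:
  fixes f :: "('a::real_normed_vector, 'b::real_normed_vector) l1_sum \<Rightarrow>\<^sub>L real"
  assumes f: "norm f = 1"
  obtains (left) g :: "'a \<Rightarrow>\<^sub>L real" where "norm g = 1" "\<And>a. f (L1 a 0) = g a"
    | (right) h :: "'b \<Rightarrow>\<^sub>L real" where "norm h = 1" "\<And>b. f (L1 0 b) = h b"
proof -
  define g where "g = f o\<^sub>L Blinfun (\<lambda>a. L1 a 0)"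
  define h where "h = f o\<^sub>L Blinfun (\<lambda>b. L1 0 b)"
  have g: "g a = f (L1 a 0)" for a
    by (simp add: g_def bounded_linear_Blinfun_apply[OF bounded_linear_L1_left])
  have h: "h b = f (L1 0 b)" for b
    by (simp add: h_def bounded_linear_Blinfun_apply[OF bounded_linear_L1_right])
  have "norm g \<le> 1"
  proof (rule norm_blinfun_bound)
    show "norm (g a) \<le> 1 * norm a" for a
      using norm_blinfun[of f "L1 a 0"] f by (simp add: g norm_l1_sum_def)
  qed simp
  moreover have "norm h \<le> 1"
  proof (rule norm_blinfun_bound)
    show "norm (h b) \<le> 1 * norm b" for b
      using norm_blinfun[of f "L1 0 b"] f by (simp add: h norm_l1_sum_def)
  qed simp
  moreover have "norm f \<le> max (norm g) (norm h)"
  proof (rule norm_blinfun_bound)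
    fix u
    have "f u = g (l1_fst u) + h (l1_snd u)"
      by (simp add: g h plus_l1_sum_def flip: blinfun.add_right)
    then have "norm (f u) \<le> norm g * norm (l1_fst u) + norm h * norm (l1_snd u)"
      using norm_blinfun[of g "l1_fst u"] norm_blinfun[of h "l1_snd u"] by simp
    also have "\<dots> \<le> max (norm g) (norm h) * norm (l1_fst u) + max (norm g) (norm h) * norm (l1_snd u)"
      by (intro add_mono mult_right_mono) auto
    finally show "norm (f u) \<le> max (norm g) (norm h) * norm u"
      by (simp add: norm_l1_sum_def distrib_left)
  qed (simp add: le_max_iff_disj)
  ultimately consider "norm g = 1" | "norm h = 1"
    using f by linarith
  then show ?thesis
    using left right g h by cases metis+
qed

text \<open>Reduces the bound to slices of a single summand; the added \<open>norm y\<close> or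
  \<open>norm x\<close> is the contribution of the coordinate where the slice point is 0.\<close>

lemma daugavet_bound_L1I:
  fixes x :: "'a::real_normed_vector" and y :: "'b::real_normed_vector"
  assumes left: "\<And>(g :: 'a \<Rightarrow>\<^sub>L real) \<epsilon> \<delta>. norm g = 1 \<Longrightarrow> \<epsilon> > 0 \<Longrightarrow> \<delta> > 0 \<Longrightarrow>
      \<exists>w \<in> slice g \<delta>. norm (w - x) + norm y > \<alpha> - \<epsilon>"
    and right: "\<And>(h :: 'b \<Rightarrow>\<^sub>L real) \<epsilon> \<delta>. norm h = 1 \<Longrightarrow> \<epsilon> > 0 \<Longrightarrow> \<delta> > 0 \<Longrightarrow>
      \<exists>w \<in> slice h \<delta>. norm (w - y) + norm x > \<alpha> - \<epsilon>"
  shows "daugavet_bound \<alpha> (L1 x y)"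
  unfolding daugavet_bound_def
proof (intro allI impI ballI)
  fix \<epsilon> \<delta> :: real and f :: "('a, 'b) l1_sum \<Rightarrow>\<^sub>L real"
  assume pos: "\<epsilon> > 0" "\<delta> > 0" and "f \<in> sphere 0 1"
  then have "norm f = 1" by simp
  then show "\<exists>w \<in> slice f \<delta>. norm (w - L1 x y) > \<alpha> - \<epsilon>"
  proof (cases rule: l1_sum_dual_cases)
    case (left g)
    with assms(1)[OF _ pos] obtain w where "w \<in> slice g \<delta>" "norm (w - x) + norm y > \<alpha> - \<epsilon>"
      by blast
    with left show ?thesis
      by (intro bexI[of _ "L1 w 0"]) (auto simp: slice_def norm_l1_sum_def)
  next
    case (right h)
    with assms(2)[OF _ pos] obtain w where "w \<in> slice h \<delta>" "norm (w - y) + norm x > \<alpha> - \<epsilon>"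
      by blast
    with right show ?thesis
      by (intro bexI[of _ "L1 0 w"]) (auto simp: slice_def norm_l1_sum_def)
  qed
qed

text \<open>Triangle inequality: x lies at distance 1 - \<open>norm x\<close> from its
  normalization.\<close>

lemma norm_diff_normalized_le:
  fixes x :: "'a::real_normed_vector"
  assumes "x \<noteq> 0" "norm x \<le> 1"
  shows "norm (w - x /\<^sub>R norm x) \<le> norm (w - x) + (1 - norm x)"
proof -
  have "x - x /\<^sub>R norm x = (1 - inverse (norm x)) *\<^sub>R x"
    by (simp add: algebra_simps)
  then have "norm (x - x /\<^sub>R norm x) = \<bar>1 - inverse (norm x)\<bar> * norm x"
    by simp
  also have "\<dots> = \<bar>(1 - inverse (norm x)) * norm x\<bar>"
    by (simp add: abs_mult)
  also have "(1 - inverse (norm x)) * norm x = norm x - 1"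
    using assms(1) by (simp add: algebra_simps)
  finally show ?thesis
    using norm_triangle_ineq[of "w - x" "x - x /\<^sub>R norm x"] assms(2) by simp
qed

text \<open>Handles a non-zero coordinate x; c stands for the norm of the other coordinate.\<close>

lemma slice_far_normalized:
  fixes g :: "'a::real_normed_vector \<Rightarrow>\<^sub>L real"
  assumes "daugavet_bound \<alpha> (x /\<^sub>R norm x)" "x \<noteq> 0" "norm x + c = 1" "c \<ge> 0"
    and "norm g = 1" "\<epsilon> > 0" "\<delta> > 0"
  shows "\<exists>w \<in> slice g \<delta>. norm (w - x) + c > \<alpha> - \<epsilon>"
proof -
  obtain w where w: "w \<in> slice g \<delta>" "norm (w - x /\<^sub>R norm x) > \<alpha> - \<epsilon>"
    using daugavet_boundD assms(1,5-7) by blast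
  have "norm (w - x /\<^sub>R norm x) \<le> norm (w - x) + c"
    using norm_diff_normalized_le[of x w] assms(2-4) by simp
  with w(2) have "norm (w - x) + c > \<alpha> - \<epsilon>" by simp
  with w(1) show ?thesis by blast
qed

text \<open>Handles a functional on the summand whose coordinate is 0; the summand 1 is the norm of
  the other coordinate.\<close>

lemma slice_far_zero:
  fixes g :: "'a::real_normed_vector \<Rightarrow>\<^sub>L real"
  assumes "\<alpha> \<le> 2" "norm g = 1" "\<epsilon> > 0" "\<delta> > 0"
  shows "\<exists>w \<in> slice g \<delta>. norm (w - 0) + 1 > \<alpha> - \<epsilon>"
proof -
  obtain w where "w \<in> slice g \<delta>" "norm w > 1 - \<epsilon>"
    using assms(2,4,3) by (rule slice_norm_gt)
  with assms(1) show ?thesis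
    by (intro bexI[of _ w]) simp_all
qed

theorem proposition4p2:
  fixes x :: "'a::banach" and y :: "'b::banach"
  assumes "L1 x y \<in> sphere 0 1"
  shows "(x \<noteq> 0 \<and> y \<noteq> 0 \<longrightarrow> dc (L1 x y) \<ge> min (dc (x /\<^sub>R norm x)) (dc (y /\<^sub>R norm y))) \<and>
         (x = 0 \<longrightarrow> dc (L1 x y) \<ge> dc y) \<and>
         (y = 0 \<longrightarrow> dc (L1 x y) \<ge> dc x)"
proof (intro conjI impI)
  have norm: "norm x + norm y = 1"
    using assms by (simp add: norm_l1_sum_def)
  {
    assume "x \<noteq> 0 \<and> y \<noteq> 0"
    show "dc (L1 x y) \<ge> min (dc (x /\<^sub>R norm x)) (dc (y /\<^sub>R norm y))"
    \<comment> \<open>Working by contradiction yields real bounds \<alpha> and \<beta> strictly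
      above \<open>dc (L1 x y)\<close>, even if some constant is infinite. Their minimum is a bound
      for both coordinates, hence for the pair.\<close>
    proof (rule ccontr)
      assume "\<not> ?thesis"
      then have less: "dc (L1 x y) < dc (x /\<^sub>R norm x)" "dc (L1 x y) < dc (y /\<^sub>R norm y)"
        by (auto simp: not_le)
      obtain \<alpha> where \<alpha>: "\<alpha> \<ge> 0" "daugavet_bound \<alpha> (x /\<^sub>R norm x)" "dc (L1 x y) < ereal \<alpha>"
        using less(1) by (rule less_dcD)
      obtain \<beta> where \<beta>: "\<beta> \<ge> 0" "daugavet_bound \<beta> (y /\<^sub>R norm y)" "dc (L1 x y) < ereal \<beta>"
        using less(2) by (rule less_dcD)
      have "daugavet_bound (min \<alpha> \<beta>) (x /\<^sub>R norm x)" "daugavet_bound (min \<alpha> \<beta>) (y /\<^sub>R norm y)"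
        using \<alpha>(2) \<beta>(2) by (auto elim: daugavet_bound_mono)
      then have "daugavet_bound (min \<alpha> \<beta>) (L1 x y)"
        using \<open>x \<noteq> 0 \<and> y \<noteq> 0\<close> norm
        by (intro daugavet_bound_L1I slice_far_normalized) (auto simp: add.commute)
      then have "ereal (min \<alpha> \<beta>) \<le> dc (L1 x y)"
        using \<alpha>(1) \<beta>(1) by (intro le_dcI) auto
      with \<alpha>(3) \<beta>(3) show False
        by (auto simp: min_def split: if_splits)
    qed
  next
    assume "x = 0"
    show "dc (L1 x y) \<ge> dc y"
    proof (rule dc_le_dcI)
      fix \<alpha> assume \<alpha>: "daugavet_bound \<alpha> y"
      have y: "norm y = 1" using norm \<open>x = 0\<close> by simp
      \<comment> \<open>On the first summand \<alpha> \<le> 2 suffices; on the second,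
        \<open>norm x\<close> = 0 leaves exactly the bound assumed for y.\<close>
      show "daugavet_bound \<alpha> (L1 x y)"
        using slice_far_zero[OF daugavet_bound_le_2[OF \<alpha> y]] \<alpha> y \<open>x = 0\<close>
        by (intro daugavet_bound_L1I) (simp_all add: daugavet_bound_def)
    qed
  next
    assume "y = 0"
    show "dc (L1 x y) \<ge> dc x"
    proof (rule dc_le_dcI)
      fix \<alpha> assume \<alpha>: "daugavet_bound \<alpha> x"
      have x: "norm x = 1" using norm \<open>y = 0\<close> by simp
      \<comment> \<open>The same argument with the summands exchanged.\<close>
      show "daugavet_bound \<alpha> (L1 x y)"
        using slice_far_zero[OF daugavet_bound_le_2[OF \<alpha> x]] \<alpha> x \<open>y = 0\<close>
        by (intro daugavet_bound_L1I) (simp_all add: daugavet_bound_def)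
    qed
  }
qed

end
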